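(* Let $M$ be a finite Galois extension of $\mathbb{Q}$ with $G=\operatorname{Gal}(M/\mathbb{Q})$, let $p$ be a prime number, $E_p=\operatorname{Emb}(M,\mathbb{C}_p)$ and $E=\operatorname{Emb}(M,\mathbb{C})$. Let $\varepsilon\in\mathcal{O}_M^*$ be a weak Minkowski unit such that $|\sigma g\varepsilon-1|_p<1$ for all $\sigma\in E_p$, $g\in G$. Let $S_p$ be a subset of $E_p$, and for each field isomorphism $\psi:\mathbb{C}_p\to\mathbb{C}$ let $S_\psi=\{\psi\circ\sigma:\sigma\in S_p\}\subset E$. Assume the $p$-adic Schanuel Conjecture (stated in the context). Then \[\operatorname{rank}\bigl(\log_p(\sigma_i g_j\varepsilon)\bigr)_{\sigma_i\in S_p,\,g_j\in G}\ \geq\ \max_\psi\Bigl\{\operatorname{rank}\bigl(\log|\tau_i g_j\varepsilon|\bigr)_{\tau_i\in S_\psi,\,g_j\in G}\Bigr\},\] where $\psi$ runs over all field isomorphisms $\mathbb{C}_p\to\mathbb{C}$.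
   Context: $\mathcal{O}_M^*$ is the unit group of the ring of integers of $M$; $\mathbb{C}_p$ is the completion of an algebraic closure of $\mathbb{Q}_p$, with absolute value $|\cdot|_p$ extending the usual one on $\mathbb{Q}_p$. $\operatorname{Emb}(M,K)$ is the set of all field embeddings $M\to K$; $\sigma g\varepsilon$ means $\sigma(g(\varepsilon))$. On the right, $|\cdot|$ is the complex modulus and $\log$ the real logarithm. A weak Minkowski unit is an element $\varepsilon\in\mathcal{O}_M^*$ such that the (multiplicative) subgroup generated by all $g\varepsilon$, $g\in G$, has finite index in $\mathcal{O}_M^*$. $\log_p:\mathbb{C}_p^*\to\mathbb{C}_p$ is the $p$-adic logarithm, given by the usual power series on $|x-1|_p<1$ and extended to $\mathbb{C}_p^*$ by $\log_p(ab)=\log_p(a)+\log_p(b)$ and $\log_p(\zeta p^s)=0$ for all roots of unity $\zeta$ and $s\in\mathbb{Z}$. $p$-adic Schanuel Conjecture (logarithmic formulation): let non-zero $\alpha_1,\dots,\alpha_n$ be algebraic over $\mathbb{Q}$ and contained in an extension of $\mathbb{Q}_p$ (inside $\mathbb{C}_p$). If $\log_p\alpha_1,\dots,\log_p\alpha_n$ are linearly independent over $\mathbb{Q}$, then they are algebraically independent over $\mathbb{Q}$. *)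

theory Defs
  imports
    "HOL-Analysis.Analysis"
    "HOL-Algebra.Generated_Groups"
    "HOL-Library.Function_Algebras"
    "HOL-Library.Poly_Mapping"
    "Jordan_Normal_Form.Matrix"
begin

text \<open>
  Fields are types of class \<^class>\<open>field_char_0\<close>; field homomorphisms and isomorphisms are
  the predicates \<^const>\<open>field_hom\<close> and \<^const>\<open>field_isom\<close>.
\<close>

section \<open>Galois extensions of the rationals and their units\<close>

definition rat_scale :: "rat \<Rightarrow> 'a::field_char_0 \<Rightarrow> 'a" where
  "rat_scale q x = of_rat q * x"

lemma vector_space_rat_scale: "vector_space rat_scale"
  by unfold_locales (simp_all add: rat_scale_def algebra_simps of_rat_add of_rat_mult)

definition Gal_rat :: "('m::field_char_0 \<Rightarrow> 'm) set" where
  "Gal_rat = {g. field_isom g \<and> (\<forall>q. g (of_rat q) = of_rat q)}"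

definition finite_Galois_over_rat :: "'m::field_char_0 itself \<Rightarrow> bool" where
  "finite_Galois_over_rat _ \<longleftrightarrow>
     (\<exists>B::'m set. finite B \<and> Modules.module.span rat_scale B = UNIV) \<and>
     {x::'m. \<forall>g\<in>Gal_rat. g x = x} = \<rat>"

definition Emb :: "('m::field \<Rightarrow> 'k::field) set" where
  "Emb = {\<sigma>. field_hom \<sigma>}"

definition int_units :: "'m::field_char_0 set" where
  "int_units = {x. x \<noteq> 0 \<and> algebraic_int x \<and> algebraic_int (inverse x)}"

definition int_unit_group :: "'m::field_char_0 monoid" where
  "int_unit_group = \<lparr>carrier = int_units, monoid.mult = (*), one = 1\<rparr>"

definition weak_Minkowski_unit :: "'m::field_char_0 \<Rightarrow> bool" where
  "weak_Minkowski_unit \<epsilon> \<longleftrightarrow> \<epsilon> \<in> int_units \<and>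
     finite (rcosets\<^bsub>int_unit_group\<^esub> (generate int_unit_group {g \<epsilon> | g. g \<in> Gal_rat}))"


section \<open>The field of p-adic complex numbers\<close>

definition padic_abs_rat :: "nat \<Rightarrow> rat \<Rightarrow> real" where
  "padic_abs_rat p q = (if q = 0 then 0 else
     real p powi (int (multiplicity (int p) (snd (quotient_of q)))
                  - int (multiplicity (int p) (fst (quotient_of q)))))"

text \<open>
  In a complete field whose absolute value extends the p-adic one on the rationals, the
  closure of the rationals is the completion of the rationals, i.e. the field of p-adic numbers.
\<close>

definition closure_rat :: "('k::field_char_0 \<Rightarrow> real) \<Rightarrow> 'k set" where
  "closure_rat v = Metric_space.mtopology UNIV (\<lambda>x y. v (x - y)) closure_of \<rat>"

definition algebraic_over :: "'k::field set \<Rightarrow> 'k \<Rightarrow> bool" where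
  "algebraic_over F x \<longleftrightarrow> (\<exists>f. f \<noteq> 0 \<and> (\<forall>i. coeff f i \<in> F) \<and> poly f x = 0)"

text \<open>
  The field \<open>'k\<close> with the absolute value \<open>v\<close> is a completion of an algebraic closure of the
  field of p-adic numbers. This determines \<open>('k, v)\<close> up to isometric isomorphism. The set
  \<open>{x. algebraic_over (closure_rat v) x}\<close> is the algebraic closure in question.
\<close>

locale padic_complex_field =
  fixes p :: nat and v :: "'k::field_char_0 \<Rightarrow> real"
  assumes prime_p: "prime p"
    and v_nonneg: "v x \<ge> 0"
    and v_eq_0_iff: "v x = 0 \<longleftrightarrow> x = 0"
    and v_mult: "v (x * y) = v x * v y"
    and v_ultrametric: "v (x + y) \<le> max (v x) (v y)"
    and v_of_rat: "v (of_rat q) = padic_abs_rat p q"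
    and complete: "Metric_space.mcomplete UNIV (\<lambda>x y. v (x - y))"
    and alg_closed:
      "\<lbrakk>degree f > 0; \<forall>i. algebraic_over (closure_rat v) (coeff f i)\<rbrakk>
        \<Longrightarrow> \<exists>x. algebraic_over (closure_rat v) x \<and> poly f x = 0"
    and dense:
      "Metric_space.mtopology UNIV (\<lambda>x y. v (x - y)) closure_of
         {x. algebraic_over (closure_rat v) x} = UNIV"
begin

lemma v_one: "v 1 = 1"
  using v_mult[of 1 1] v_eq_0_iff[of 1] by simp

lemma v_minus: "v (- x) = v x"
proof -
  have "v (- 1) * v (- 1) = 1"
    using v_mult[of "- 1" "- 1"] by (simp add: v_one)
  then have "v (- 1) = 1"
    using v_nonneg[of "- 1"] by (auto simp: square_eq_1_iff)
  then show ?thesis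
    using v_mult[of "- 1" x] by simp
qed

sublocale Metric_space UNIV "\<lambda>x y. v (x - y)"
proof
  fix x y z :: 'k
  show "0 \<le> v (x - y)" by (rule v_nonneg)
  show "v (x - y) = v (y - x)" using v_minus[of "x - y"] by simp
  show "v (x - y) = 0 \<longleftrightarrow> x = y" by (simp add: v_eq_0_iff)
  show "v (x - z) \<le> v (x - y) + v (y - z)"
    using v_ultrametric[of "x - y" "y - z"] v_nonneg[of "x - y"] v_nonneg[of "y - z"] by simp
qed

end

text \<open>
  \<open>L\<close> is the p-adic logarithm on the non-zero elements. These conditions determine it there,
  because every non-zero element of the field has a positive power of the form
  \<open>\<zeta> * p powi s * u\<close> with \<open>\<zeta>\<close> a root of unity and \<open>v (u - 1) < 1\<close>. The value of \<open>L\<close> at 0 is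
  arbitrary and not used.
\<close>

definition is_padic_log :: "nat \<Rightarrow> ('k::field_char_0 \<Rightarrow> real) \<Rightarrow> ('k \<Rightarrow> 'k) \<Rightarrow> bool" where
  "is_padic_log p v L \<longleftrightarrow>
     (\<forall>x. v (x - 1) < 1 \<longrightarrow>
        limitin (Metric_space.mtopology UNIV (\<lambda>x y. v (x - y)))
          (\<lambda>N. \<Sum>n=1..N. (- 1) ^ (n + 1) * (x - 1) ^ n / of_nat n) (L x) sequentially) \<and>
     (\<forall>a b. a \<noteq> 0 \<longrightarrow> b \<noteq> 0 \<longrightarrow> L (a * b) = L a + L b) \<and>
     (\<forall>\<zeta> (n::nat) (s::int). n > 0 \<longrightarrow> \<zeta> ^ n = 1 \<longrightarrow> L (\<zeta> * of_nat p powi s) = 0)"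


section \<open>The p-adic Schanuel conjecture\<close>

definition rat_lin_independent :: "nat \<Rightarrow> (nat \<Rightarrow> 'k::field_char_0) \<Rightarrow> bool" where
  "rat_lin_independent n x \<longleftrightarrow>
     (\<forall>q::nat \<Rightarrow> rat. (\<Sum>i<n. of_rat (q i) * x i) = 0 \<longrightarrow> (\<forall>i<n. q i = 0))"

text \<open>
  Multivariate polynomials over the rationals are finitely supported maps from monomials
  (finitely supported exponent functions) to coefficients.
\<close>

definition rat_mpoly_eval ::
  "((nat \<Rightarrow>\<^sub>0 nat) \<Rightarrow>\<^sub>0 rat) \<Rightarrow> (nat \<Rightarrow> 'k::field_char_0) \<Rightarrow> 'k" where
  "rat_mpoly_eval P x =
     (\<Sum>m\<in>Poly_Mapping.keys P. of_rat (Poly_Mapping.lookup P m) *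
        (\<Prod>i\<in>Poly_Mapping.keys m. x i ^ Poly_Mapping.lookup m i))"

definition rat_alg_independent :: "nat \<Rightarrow> (nat \<Rightarrow> 'k::field_char_0) \<Rightarrow> bool" where
  "rat_alg_independent n x \<longleftrightarrow>
     (\<forall>P. (\<forall>m\<in>Poly_Mapping.keys P. Poly_Mapping.keys m \<subseteq> {..<n}) \<longrightarrow>
          rat_mpoly_eval P x = 0 \<longrightarrow> P = 0)"

definition padic_Schanuel_conjecture :: "('k::field_char_0 \<Rightarrow> 'k) \<Rightarrow> bool" where
  "padic_Schanuel_conjecture L \<longleftrightarrow>
     (\<forall>n (\<alpha>::nat \<Rightarrow> 'k). (\<forall>i<n. \<alpha> i \<noteq> 0 \<and> algebraic (\<alpha> i)) \<longrightarrow>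
        rat_lin_independent n (\<lambda>i. L (\<alpha> i)) \<longrightarrow> rat_alg_independent n (\<lambda>i. L (\<alpha> i)))"


section \<open>Rank of a matrix indexed by arbitrary sets\<close>

definition fun_scale :: "'a::field \<Rightarrow> ('i \<Rightarrow> 'a) \<Rightarrow> 'i \<Rightarrow> 'a" where
  "fun_scale c x = (\<lambda>i. c * x i)"

lemma vector_space_fun_scale: "vector_space fun_scale"
  by unfold_locales (simp_all add: fun_scale_def fun_eq_iff algebra_simps)

text \<open>
  The dimension of the span of the columns of \<open>(A i j)\<close> with \<open>i \<in> I\<close> and \<open>j \<in> J\<close>; columns are
  functions on row indices, extended by 0 outside \<open>I\<close>.
\<close>

definition matrix_rank :: "'i set \<Rightarrow> 'j set \<Rightarrow> ('i \<Rightarrow> 'j \<Rightarrow> 'a::field) \<Rightarrow> nat" where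
  "matrix_rank I J A =
     vector_space.dim fun_scale ((\<lambda>j i. if i \<in> I then A i j else 0) ` J)"

end

theory Submission
  imports Defs "Jordan_Normal_Form.Determinant"
begin

text \<open>
  On principal units the kernel of the p-adic logarithm consists of roots of unity, so every
  rational linear relation between the numbers \<open>log\<^sub>p (\<sigma> (g \<epsilon>))\<close> also holds between the
  corresponding numbers \<open>ln (cmod (\<psi> (\<sigma> (g \<epsilon>))))\<close>. Hence both matrices arise from one matrix of
  rational linear forms, by evaluating it at a \<open>\<rat>\<close>-basis \<open>log\<^sub>p (b i)\<close> of the span of the p-adic
  logarithms and at the numbers \<open>ln (cmod (\<psi> (b i)))\<close>. By the Schanuel conjecture the first
  evaluation point is generic: a minor that vanishes there vanishes identically, so the rank at
  any other point is at most the p-adic one.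
\<close>

section \<open>The kernel of the p-adic logarithm on principal units\<close>

context padic_complex_field
begin

section \<open>Elementary properties of the absolute value\<close>

lemma v_zero: "v 0 = 0"
  by (simp add: v_eq_0_iff)

lemma v_power: "v (x ^ n) = v x ^ n"
  by (induction n) (simp_all add: v_one v_mult)

lemma v_inverse: "v (inverse x) = inverse (v x)"
proof (cases "x = 0")
  case False
  then have "v x * v (inverse x) = 1"
    using v_mult[of x "inverse x"] by (simp add: v_one)
  then show ?thesis
    by (metis inverse_unique)
qed (simp add: v_zero)

lemma v_sum_le:
  assumes "\<And>a. a \<in> A \<Longrightarrow> v (f a) \<le> c" and "0 \<le> c"
  shows "v (sum f A) \<le> c"
  using assms(1)
proof (induction A rule: infinite_finite_induct)
  case (insert a A)
  then have "v (f a) \<le> c" "v (sum f A) \<le> c"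
    by auto
  then have "v (f a + sum f A) \<le> c"
    using v_ultrametric[of "f a" "sum f A"] by (meson max.bounded_iff order_trans)
  then show ?case
    using insert by simp
qed (auto simp: v_zero assms(2))

lemma v_of_nat:
  assumes "n > 0"
  shows "v (of_nat n) = 1 / real (p ^ multiplicity p n)"
proof -
  have q: "quotient_of (of_nat n) = (int n, 1)"
    using quotient_of_int[of "int n"] by (simp add: Rat.of_int_def)
  have "v (of_nat n) = v (of_rat (of_nat n))"
    by simp
  also have "\<dots> = padic_abs_rat p (of_nat n)"
    by (rule v_of_rat)
  also have "\<dots> = real p powi (- int (multiplicity (int p) (int n)))"
    using assms by (simp add: padic_abs_rat_def q)
  also have "multiplicity (int p) (int n) = multiplicity p n"
    by (simp add: multiplicity_def flip: of_nat_power)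
  finally show ?thesis
    by (simp add: power_int_minus divide_inverse)
qed

text \<open>The power of \<open>p\<close> dividing \<open>n\<close> is at most \<open>n\<close>.
  This crude bound is uniform in \<open>p\<close> and controls the denominators of the logarithm
  series.\<close>

lemma v_of_nat_ge:
  assumes "n > 0"
  shows "1 / real n \<le> v (of_nat n)"
proof -
  have "p ^ multiplicity p n \<le> n"
    using assms by (intro dvd_imp_le multiplicity_dvd)
  moreover have "0 < p ^ multiplicity p n"
    using prime_p by (simp add: prime_gt_0_nat)
  ultimately show ?thesis
    unfolding v_of_nat[OF assms] by (intro divide_left_mono) (auto simp: of_nat_le_iff assms simp del: of_nat_power)
qed

lemma v_of_nat_p_less_1: "v (of_nat p) < 1"
  using prime_p prime_gt_1_nat[OF prime_p] v_of_nat[of p] by simp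

section \<open>The multiplicative group of principal units\<close>

definition principal_units :: "'k set" where
  "principal_units = {u. v (u - 1) < 1}"

lemma v_principal_unit:
  assumes "u \<in> principal_units"
  shows "v u = 1"
proof -
  have "v u \<le> 1"
    using v_ultrametric[of "u - 1" 1] assms by (simp add: principal_units_def v_one)
  moreover have "1 \<le> max (v u) (v (u - 1))"
    using v_ultrametric[of u "1 - u"] v_minus[of "u - 1"] by (simp add: v_one)
  ultimately show ?thesis
    using assms by (simp add: principal_units_def max_def split: if_splits)
qed

lemma principal_unit_nonzero: "u \<in> principal_units \<Longrightarrow> u \<noteq> 0"
  using v_principal_unit v_zero by force

lemma one_principal_unit: "1 \<in> principal_units"
  by (simp add: principal_units_def v_zero)

text \<open>Write \<open>u * w - 1\<close> as \<open>(u - 1) + u * (w - 1)\<close>. This gives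
  closure under products and, by iteration, the bound for powers.\<close>

lemma v_mult_minus_one_le:
  assumes "v u = 1"
  shows "v (u * w - 1) \<le> max (v (u - 1)) (v (w - 1))"
proof -
  have "v (u * (w - 1)) = v (w - 1)"
    by (simp add: v_mult assms)
  moreover have "u * w - 1 = (u - 1) + u * (w - 1)"
    by (simp add: algebra_simps)
  ultimately show ?thesis
    using v_ultrametric[of "u - 1" "u * (w - 1)"] by (simp only:)
qed

lemma mult_principal_unit:
  "u \<in> principal_units \<Longrightarrow> w \<in> principal_units \<Longrightarrow> u * w \<in> principal_units"
  using v_mult_minus_one_le[of u w] v_principal_unit[of u] by (auto simp: principal_units_def)

lemma inverse_principal_unit:
  assumes "u \<in> principal_units"
  shows "inverse u \<in> principal_units"
proof -
  have "inverse u - 1 = inverse u * (- (u - 1))"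
    using principal_unit_nonzero[OF assms] by (simp add: field_simps)
  then have "v (inverse u - 1) = v (u - 1)"
    by (metis mult_1 inverse_1 v_inverse v_minus v_mult v_principal_unit[OF assms])
  then show ?thesis
    using assms by (simp add: principal_units_def)
qed

lemma power_principal_unit: "u \<in> principal_units \<Longrightarrow> u ^ n \<in> principal_units"
  by (induction n) (auto intro: mult_principal_unit one_principal_unit)

lemma power_int_principal_unit: "u \<in> principal_units \<Longrightarrow> u powi n \<in> principal_units"
  by (auto simp: power_int_def intro: inverse_principal_unit power_principal_unit)

lemma prod_principal_unit:
  "(\<And>a. a \<in> A \<Longrightarrow> f a \<in> principal_units) \<Longrightarrow> prod f A \<in> principal_units"
  by (induction A rule: infinite_finite_induct) (auto intro: mult_principal_unit one_principal_unit)

section \<open>Powers of principal units and the logarithm series near 1\<close>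

lemma v_power_minus_one_le:
  assumes "u \<in> principal_units"
  shows "v (u ^ n - 1) \<le> v (u - 1)"
proof (induction n)
  case (Suc n)
  then show ?case
    using v_mult_minus_one_le[of u "u ^ n"] v_principal_unit[OF assms] by simp
qed (simp add: v_zero v_nonneg)

text \<open>Factor out \<open>u - 1\<close>. The cofactor is a sum of \<open>p\<close> powers of
  \<open>u\<close>, each within \<open>v (u - 1)\<close> of 1, hence is \<open>of_nat p\<close> up
  to an error of that size.\<close>

lemma v_power_p_minus_one_le:
  assumes "u \<in> principal_units"
  shows "v (u ^ p - 1) \<le> v (u - 1) * max (v (of_nat p)) (v (u - 1))"
proof -
  have "(\<Sum>i<p. u ^ i) = of_nat p + (\<Sum>i<p. u ^ i - 1)"
    by (simp add: sum_subtractf)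
  moreover have "v (\<Sum>i<p. u ^ i - 1) \<le> v (u - 1)"
    by (intro v_sum_le v_power_minus_one_le assms v_nonneg)
  ultimately have "v (\<Sum>i<p. u ^ i) \<le> max (v (of_nat p)) (v (u - 1))"
    using v_ultrametric[of "of_nat p" "\<Sum>i<p. u ^ i - 1"] by auto
  then show ?thesis
    by (simp add: power_diff_1_eq v_mult mult_left_mono v_nonneg)
qed

text \<open>Repeated \<open>p\<close>-th powers contract towards 1 at a geometric rate.\<close>

lemma exists_power_near_one:
  assumes "u \<in> principal_units" and "0 < e"
  shows "\<exists>n>0. v (u ^ n - 1) < e"
proof -
  \<comment> \<open>This ratio serves every iteration, because the distance of a power of
    \<open>u\<close> from 1 never exceeds \<open>v (u - 1)\<close>.\<close>
  define r where "r = max (v (of_nat p)) (v (u - 1))"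
  have r: "0 \<le> r" "r < 1"
    using v_of_nat_p_less_1 assms v_nonneg by (auto simp: r_def principal_units_def le_max_iff_disj)
  have bound: "v (u ^ (p ^ k) - 1) \<le> r * r ^ k" for k
  proof (induction k)
    case (Suc k)
    let ?w = "u ^ (p ^ k)"
    have "v (?w - 1) \<le> v (u - 1)"
      by (rule v_power_minus_one_le[OF assms(1)])
    then have "max (v (of_nat p)) (v (?w - 1)) \<le> r"
      by (auto simp: r_def)
    then have "v (?w ^ p - 1) \<le> r * r ^ k * r"
      using v_power_p_minus_one_le[OF power_principal_unit[OF assms(1), of "p ^ k"]] Suc r
      by (meson mult_mono order_trans v_nonneg mult_nonneg_nonneg zero_le_power le_max_iff_disj)
    then show ?case
      by (simp add: power_mult[symmetric] mult.commute mult.left_commute)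
  qed (simp add: r_def)
  obtain k where k: "r ^ k < e"
    using real_arch_pow_inv[OF assms(2) r(2)] by auto
  have "r * r ^ k \<le> r ^ k"
    using r by (simp add: mult_left_le_one_le)
  then have "v (u ^ (p ^ k) - 1) < e"
    using bound[of k] k by linarith
  then show ?thesis
    using prime_p by (intro exI[of _ "p ^ k"]) (simp add: prime_gt_0_nat)
qed

text \<open>Since \<open>v (of_nat n) \<ge> 1 / n\<close>, the term is at most \<open>v y\<close>
  times \<open>n * (1 / 4) ^ (n - 1)\<close>. The radius 1/4 makes that factor at most 1/2 from
  \<open>n = 2\<close> on, with equality there, whatever the prime is.\<close>

lemma v_log_term_le:
  assumes "v y \<le> 1 / 4" and "2 \<le> n"
  shows "v ((- 1) ^ (n + 1) * y ^ n / of_nat n) \<le> v y / 2"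
proof -
  obtain m where m: "n = Suc m" "1 \<le> m"
    using assms(2) by (cases n) auto
  have n4: "real (Suc m) * (1 / 4) ^ m \<le> 1 / 2"
    using m(2) by (induction m rule: dec_induct) (auto simp: field_simps)
  have "inverse (v (of_nat n)) \<le> real n"
    using le_imp_inverse_le[OF v_of_nat_ge[of n]] m by simp
  moreover have "v ((- 1) ^ (n + 1) * y ^ n / of_nat n) = v y ^ n * inverse (v (of_nat n))"
    by (simp add: divide_inverse v_mult v_power v_inverse v_minus v_one)
  ultimately have "v ((- 1) ^ (n + 1) * y ^ n / of_nat n) \<le> v y ^ n * real n"
    by (simp add: mult_left_mono v_nonneg)
  also have "\<dots> = v y * (real (Suc m) * v y ^ m)"
    by (simp add: m)
  also have "\<dots> \<le> v y * (real (Suc m) * (1 / 4) ^ m)"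
    by (intro mult_left_mono power_mono assms v_nonneg) auto
  also have "\<dots> \<le> v y * (1 / 2)"
    by (intro mult_left_mono n4 v_nonneg)
  finally show ?thesis
    by simp
qed

text \<open>The linear term dominates: the rest of each partial sum has at most half its size, so
  the partial sums cannot become smaller than \<open>v (x - 1)\<close>.\<close>

lemma log_zero_near_one:
  assumes small: "v (x - 1) \<le> 1 / 4"
    and lim: "limitin mtopology (\<lambda>N. \<Sum>n=1..N. (- 1) ^ (n + 1) * (x - 1) ^ n / of_nat n) 0 sequentially"
  shows "x = 1"
proof (rule ccontr)
  assume "x \<noteq> 1"
  define y where "y = x - 1"
  define S where "S N = (\<Sum>n=1..N. (- 1) ^ (n + 1) * y ^ n / of_nat n)" for N
  have y: "0 < v y"
    using \<open>x \<noteq> 1\<close> v_nonneg[of y] v_eq_0_iff[of y] by (auto simp: y_def less_le)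
  have "eventually (\<lambda>N. v (S N - 0) < v y) sequentially"
    using lim y unfolding limit_metric_sequentially y_def[symmetric] S_def[symmetric]
    by (auto simp: eventually_sequentially)
  then obtain N0 where N0: "\<And>N. N \<ge> N0 \<Longrightarrow> v (S N - 0) < v y"
    by (auto simp: eventually_sequentially)
  \<comment> \<open>At least 1, so that the linear term belongs to the sum.\<close>
  define N where "N = max N0 1"
  have "S N = y + (\<Sum>n=2..N. (- 1) ^ (n + 1) * y ^ n / of_nat n)"
    unfolding S_def by (subst sum.atLeast_Suc_atMost) (auto simp: N_def numeral_2_eq_2)
  moreover have "v (\<Sum>n=2..N. (- 1) ^ (n + 1) * y ^ n / of_nat n) \<le> v y / 2"
    using small y by (intro v_sum_le v_log_term_le) (auto simp: y_def)
  ultimately have "v (y - S N) \<le> v y / 2"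
    by (metis (no_types, lifting) add_diff_cancel_left' minus_diff_eq v_minus)
  moreover have "v y \<le> max (v (S N)) (v (y - S N))"
    using v_ultrametric[of "S N" "y - S N"] by simp
  moreover have "v (S N) < v y"
    using N0[of N] by (simp add: N_def)
  ultimately show False
    using y by auto
qed

end

section \<open>The logarithm as a homomorphism, and its kernel\<close>

lemma padic_log_mult:
  "is_padic_log p v L \<Longrightarrow> a \<noteq> 0 \<Longrightarrow> b \<noteq> 0 \<Longrightarrow> L (a * b) = L a + L b"
  by (simp add: is_padic_log_def)

lemma padic_log_one:
  assumes "is_padic_log p v L"
  shows "L 1 = 0"
proof -
  have "L (1 * of_nat p powi 0) = 0"
    using assms unfolding is_padic_log_def
    by (elim conjE allE[of _ 1] allE[of _ 0]) simp
  then show ?thesis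
    by simp
qed

lemma padic_log_power:
  assumes "is_padic_log p v L" and "a \<noteq> 0"
  shows "L (a ^ n) = of_nat n * L a"
  by (induction n) (simp_all add: padic_log_one[OF assms(1)] padic_log_mult[OF assms(1)] assms(2) algebra_simps)

lemma padic_log_inverse:
  assumes "is_padic_log p v L" and "a \<noteq> 0"
  shows "L (inverse a) = - L a"
proof -
  have "L a + L (inverse a) = 0"
    using padic_log_mult[OF assms(1), of a "inverse a"] padic_log_one[OF assms(1)] assms(2) by simp
  then show ?thesis
    by (simp add: eq_neg_iff_add_eq_0 add.commute)
qed

lemma padic_log_power_int:
  assumes "is_padic_log p v L" and "a \<noteq> 0"
  shows "L (a powi k) = of_int k * L a"
proof (cases "k \<ge> 0")
  case True
  then show ?thesis
    by (simp add: power_int_def padic_log_power[OF assms])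
next
  case False
  then show ?thesis
    using padic_log_power[OF assms(1), of "inverse a" "nat (- k)"] assms(2)
    by (simp add: power_int_def padic_log_inverse[OF assms])
qed

lemma padic_log_prod:
  assumes "is_padic_log p v L" and "\<And>a. a \<in> A \<Longrightarrow> f a \<noteq> 0"
  shows "L (prod f A) = (\<Sum>a\<in>A. L (f a))"
  using assms(2)
  by (induction A rule: infinite_finite_induct)
    (simp_all add: padic_log_one[OF assms(1)] padic_log_mult[OF assms(1)])

text \<open>Some power of \<open>u\<close> lies in the small disc where the series vanishes only at
  1, and its logarithm is a multiple of \<open>L u\<close>, hence 0.\<close>

lemma (in padic_complex_field) padic_log_zero_imp_root_of_unity:
  assumes L: "is_padic_log p v L" and u: "u \<in> principal_units" and "L u = 0"
  shows "\<exists>n>0. u ^ n = 1"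
proof -
  obtain n where n: "n > 0" "v (u ^ n - 1) < 1 / 4"
    using exists_power_near_one[OF u, of "1 / 4"] by auto
  have "L (u ^ n) = 0"
    using padic_log_power[OF L principal_unit_nonzero[OF u]] assms(3) by simp
  moreover have "v (u ^ n - 1) < 1"
    using n(2) by simp
  then have "limitin mtopology
      (\<lambda>N. \<Sum>i=1..N. (- 1) ^ (i + 1) * (u ^ n - 1) ^ i / of_nat i) (L (u ^ n)) sequentially"
    using L unfolding is_padic_log_def by blast
  ultimately have "limitin mtopology
      (\<lambda>N. \<Sum>i=1..N. (- 1) ^ (i + 1) * (u ^ n - 1) ^ i / of_nat i) 0 sequentially"
    by simp
  then have "u ^ n = 1"
    using n(2) by (intro log_zero_near_one) auto
  with n(1) show ?thesis
    by blast
qed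

section \<open>Linear relations between logarithms\<close>

lemma common_denominator:
  fixes q :: "'i \<Rightarrow> rat"
  assumes "finite A"
  shows "\<exists>N>0. \<exists>k. \<forall>a\<in>A. of_nat N * q a = of_int (k a)"
  using assms
proof (induction A)
  case (insert b A)
  then obtain N k where N: "N > 0" "\<forall>a\<in>A. of_nat N * q a = of_int (k a)"
    by blast
  obtain m n where mn: "q b = of_int m / of_int n" "n > 0"
    by (meson quotient_of_div quotient_of_denom_pos surj_pair)
  define k' where "k' a = (if a = b then int N * m else k a * n)" for a
  have "of_nat (N * nat n) * q a = of_int (k' a)" if "a \<in> insert b A" for a
  proof (cases "a = b")
    case True
    then show ?thesis
      using mn by (simp add: k'_def)
  next
    case False
    then have "of_nat N * q a = of_int (k a)"
      using that N by blast
    then show ?thesis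
      using mn False by (simp add: k'_def mult.commute mult.left_commute)
  qed
  then show ?case
    using N(1) mn(2) by (intro exI[of _ "N * nat n"]) auto
qed (auto intro: exI[of _ 1])

lemma (in field_hom) hom_power_int: "hom (x powi k) = hom x powi k"
  by (simp add: power_int_def hom_distribs)

lemma ln_power_int:
  fixes x :: real
  assumes "x > 0"
  shows "ln (x powi k) = of_int k * ln x"
  using assms by (cases "k \<ge> 0") (auto simp: power_int_def ln_realpow ln_inverse)

text \<open>A relation with integer coefficients says that a product of powers of the \<open>\<beta> a\<close> is a root
  of unity, and this survives under every embedding into the complex numbers.\<close>

lemma (in padic_complex_field) padic_log_relation_imp_ln_relation:
  fixes \<psi> :: "'k \<Rightarrow> complex" and q :: "'i \<Rightarrow> rat"
  assumes L: "is_padic_log p v L" and psi: "field_hom \<psi>" and A: "finite A"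
    and beta: "\<And>a. a \<in> A \<Longrightarrow> \<beta> a \<in> principal_units"
    and rel: "(\<Sum>a\<in>A. of_rat (q a) * L (\<beta> a)) = 0"
  shows "(\<Sum>a\<in>A. of_rat (q a) * ln (cmod (\<psi> (\<beta> a)))) = 0"
proof -
  interpret field_hom \<psi>
    by (rule psi)
  obtain N k where N: "N > 0" and k: "\<forall>a\<in>A. of_nat N * q a = of_int (k a)"
    using common_denominator[OF A] by blast
  define u where "u = (\<Prod>a\<in>A. \<beta> a powi k a)"
  have nz: "\<beta> a \<noteq> 0" if "a \<in> A" for a
    using beta that principal_unit_nonzero by blast
  \<comment> \<open>Polymorphic in the field: it is applied to the p-adic relation and again to the
    real one.\<close>
  have kq: "(of_int (k a) :: 'c::field_char_0) = of_nat N * of_rat (q a)" if "a \<in> A" for a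
    using k that by (metis of_rat_mult of_rat_of_int_eq of_rat_of_nat_eq)
  have "L u = (\<Sum>a\<in>A. of_int (k a) * L (\<beta> a))"
    using nz by (simp add: u_def padic_log_prod[OF L] padic_log_power_int[OF L])
  also have "\<dots> = of_nat N * (\<Sum>a\<in>A. of_rat (q a) * L (\<beta> a))"
    by (simp add: sum_distrib_left kq mult.assoc)
  finally have "L u = 0"
    by (simp add: rel)
  moreover have "u \<in> principal_units"
    unfolding u_def by (intro prod_principal_unit power_int_principal_unit beta)
  ultimately obtain n where n: "n > 0" "u ^ n = 1"
    using padic_log_zero_imp_root_of_unity[OF L] by blast
  \<comment> \<open>Being a root of unity is an algebraic property, so \<open>\<psi>\<close>
    preserves it, and it fixes the complex modulus.\<close>
  then have "\<psi> u ^ n = 1"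
    by (metis hom_one hom_power)
  then have "cmod (\<psi> u) = 1"
    using n(1) power_eq_1_iff by blast
  then have "0 = ln (cmod (\<psi> u))"
    by simp
  also have "\<dots> = ln (\<Prod>a\<in>A. cmod (\<psi> (\<beta> a)) powi k a)"
    by (simp add: u_def hom_prod hom_power_int norm_power_int flip: prod_norm)
  also have "\<dots> = (\<Sum>a\<in>A. ln (cmod (\<psi> (\<beta> a)) powi k a))"
    using nz by (intro ln_prod A) simp_all
  also have "\<dots> = (\<Sum>a\<in>A. of_int (k a) * ln (cmod (\<psi> (\<beta> a))))"
    using nz by (intro sum.cong) (simp_all add: ln_power_int)
  also have "\<dots> = of_nat N * (\<Sum>a\<in>A. of_rat (q a) * ln (cmod (\<psi> (\<beta> a))))"
    by (simp add: sum_distrib_left kq mult.assoc)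
  finally show ?thesis
    using N by simp
qed

section \<open>Evaluation of polynomials at two points\<close>

definition monomial_eval :: "(nat \<Rightarrow>\<^sub>0 nat) \<Rightarrow> (nat \<Rightarrow> 'k::field_char_0) \<Rightarrow> 'k" where
  "monomial_eval m x = (\<Prod>i\<in>Poly_Mapping.keys m. x i ^ Poly_Mapping.lookup m i)"

text \<open>Exponents 0 contribute factors 1, so monomials with different supports can be compared
  over a common index set.\<close>

lemma monomial_eval_superset:
  assumes "finite K" "Poly_Mapping.keys m \<subseteq> K"
  shows "monomial_eval m x = (\<Prod>i\<in>K. x i ^ Poly_Mapping.lookup m i)"
  unfolding monomial_eval_def
  by (rule prod.mono_neutral_left) (use assms in \<open>auto simp: in_keys_iff\<close>)

lemma monomial_eval_add: "monomial_eval (m + m') x = monomial_eval m x * monomial_eval m' x"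
proof -
  let ?K = "Poly_Mapping.keys m \<union> Poly_Mapping.keys m'"
  have "finite ?K"
    by simp
  then show ?thesis
    using monomial_eval_superset[of ?K m x] monomial_eval_superset[of ?K m' x]
      monomial_eval_superset[of ?K "m + m'" x] Poly_Mapping.keys_add[of m m']
    by (simp add: lookup_add power_add prod.distrib)
qed

lemma rat_mpoly_eval_superset:
  assumes "finite K" "Poly_Mapping.keys P \<subseteq> K"
  shows "rat_mpoly_eval P x = (\<Sum>m\<in>K. of_rat (Poly_Mapping.lookup P m) * monomial_eval m x)"
  unfolding rat_mpoly_eval_def monomial_eval_def[symmetric]
  by (rule sum.mono_neutral_left) (use assms in \<open>auto simp: in_keys_iff\<close>)

lemma rat_mpoly_eval_add: "rat_mpoly_eval (P + Q) x = rat_mpoly_eval P x + rat_mpoly_eval Q x"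
proof -
  let ?K = "Poly_Mapping.keys P \<union> Poly_Mapping.keys Q"
  have "finite ?K"
    by simp
  then show ?thesis
    using rat_mpoly_eval_superset[of ?K P x] rat_mpoly_eval_superset[of ?K Q x]
      rat_mpoly_eval_superset[of ?K "P + Q" x] Poly_Mapping.keys_add[of P Q]
    by (simp add: lookup_add of_rat_add distrib_right sum.distrib)
qed

lemma rat_mpoly_eval_single:
  "rat_mpoly_eval (Poly_Mapping.single m c) x = of_rat c * monomial_eval m x"
  by (simp add: rat_mpoly_eval_def monomial_eval_def)

lemma rat_mpoly_eval_zero: "rat_mpoly_eval 0 x = 0"
  by (simp add: rat_mpoly_eval_def)

text \<open>Updating at a key outside the support is the same as adding a single term. This form of
  induction suits additive maps.\<close>

lemma poly_mapping_single_induct [case_names zero add]: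
  assumes "Q 0"
    and "\<And>m c P. Q P \<Longrightarrow> Q (Poly_Mapping.single m c + P)"
  shows "Q P"
proof (induction P rule: Poly_Mapping.update_induct)
  case (update P a b)
  then have "Poly_Mapping.update a b P = Poly_Mapping.single a b + P"
    by (intro poly_mapping_eqI) (auto simp: lookup_update lookup_add lookup_single in_keys_iff when_def)
  then show ?case
    using assms(2)[OF update(3)] by simp
qed (rule assms(1))

text \<open>Both sides are additive in each factor, so two inductions reduce the claim to a product
  of two single terms.\<close>

lemma rat_mpoly_eval_mult: "rat_mpoly_eval (P * Q) x = rat_mpoly_eval P x * rat_mpoly_eval Q x"
proof -
  have single: "rat_mpoly_eval (Poly_Mapping.single m c * Q) x =
      rat_mpoly_eval (Poly_Mapping.single m c) x * rat_mpoly_eval Q x" for m c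
    by (induction Q rule: poly_mapping_single_induct)
      (simp_all add: rat_mpoly_eval_zero distrib_left rat_mpoly_eval_add mult_single
        rat_mpoly_eval_single monomial_eval_add of_rat_mult)
  show ?thesis
    by (induction P rule: poly_mapping_single_induct)
      (simp_all add: rat_mpoly_eval_zero distrib_right rat_mpoly_eval_add single)
qed

text \<open>The image of the polynomial ring in \<open>n\<close> variables under simultaneous
  evaluation at \<open>x\<close> and \<open>y\<close>. Computing in this subring of the product of
  the two fields replaces a matrix of polynomials by two matrices of values that share their
  polynomials.\<close>

definition eval_pairs ::
  "nat \<Rightarrow> (nat \<Rightarrow> 'k::field_char_0) \<Rightarrow> (nat \<Rightarrow> 'l::field_char_0) \<Rightarrow> ('k \<times> 'l) set" where
  "eval_pairs n x y = {(rat_mpoly_eval P x, rat_mpoly_eval P y) | P.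
     \<forall>m\<in>Poly_Mapping.keys P. Poly_Mapping.keys m \<subseteq> {..<n}}"

lemma eval_pairs_add:
  assumes "(a, b) \<in> eval_pairs n x y" "(a', b') \<in> eval_pairs n x y"
  shows "(a + a', b + b') \<in> eval_pairs n x y"
proof -
  obtain P P' where P: "\<forall>m\<in>Poly_Mapping.keys P. Poly_Mapping.keys m \<subseteq> {..<n}"
      "\<forall>m\<in>Poly_Mapping.keys P'. Poly_Mapping.keys m \<subseteq> {..<n}"
    and eq: "a = rat_mpoly_eval P x" "b = rat_mpoly_eval P y"
      "a' = rat_mpoly_eval P' x" "b' = rat_mpoly_eval P' y"
    using assms by (auto simp: eval_pairs_def)
  have "\<forall>m\<in>Poly_Mapping.keys (P + P'). Poly_Mapping.keys m \<subseteq> {..<n}"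
    using P Poly_Mapping.keys_add[of P P'] by blast
  then show ?thesis
    unfolding eval_pairs_def eq by (auto simp: rat_mpoly_eval_add intro!: exI[of _ "P + P'"])
qed

lemma eval_pairs_mult:
  assumes "(a, b) \<in> eval_pairs n x y" "(a', b') \<in> eval_pairs n x y"
  shows "(a * a', b * b') \<in> eval_pairs n x y"
proof -
  obtain P P' where P: "\<forall>m\<in>Poly_Mapping.keys P. Poly_Mapping.keys m \<subseteq> {..<n}"
      "\<forall>m\<in>Poly_Mapping.keys P'. Poly_Mapping.keys m \<subseteq> {..<n}"
    and eq: "a = rat_mpoly_eval P x" "b = rat_mpoly_eval P y"
      "a' = rat_mpoly_eval P' x" "b' = rat_mpoly_eval P' y"
    using assms by (auto simp: eval_pairs_def)
  have "Poly_Mapping.keys m \<subseteq> {..<n}" if m: "m \<in> Poly_Mapping.keys (P * P')" for m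
  proof -
    obtain m1 m2 where "m = m1 + m2" "m1 \<in> Poly_Mapping.keys P" "m2 \<in> Poly_Mapping.keys P'"
      using m Poly_Mapping.keys_mult[of P P'] by blast
    then show ?thesis
      using P Poly_Mapping.keys_add[of m1 m2] by blast
  qed
  then show ?thesis
    unfolding eval_pairs_def eq by (auto simp: rat_mpoly_eval_mult intro!: exI[of _ "P * P'"])
qed

lemma eval_pairs_of_rat: "(of_rat c, of_rat c) \<in> eval_pairs n x y"
  unfolding eval_pairs_def
  by (auto simp: rat_mpoly_eval_single monomial_eval_def split: if_splits intro!: exI[of _ "Poly_Mapping.single 0 c"])

lemma eval_pairs_var: "i < n \<Longrightarrow> (x i, y i) \<in> eval_pairs n x y"
  unfolding eval_pairs_def
  by (auto simp: rat_mpoly_eval_single monomial_eval_def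
      intro!: exI[of _ "Poly_Mapping.single (Poly_Mapping.single i 1) 1"])

text \<open>Algebraic independence of \<open>x\<close> is used here: the only polynomial vanishing
  at \<open>x\<close> is 0, which vanishes at \<open>y\<close> too.\<close>

lemma eval_pairs_zero_left:
  assumes "rat_alg_independent n x" "(0, b) \<in> eval_pairs n x y"
  shows "b = 0"
proof -
  obtain P where "\<forall>m\<in>Poly_Mapping.keys P. Poly_Mapping.keys m \<subseteq> {..<n}"
      "rat_mpoly_eval P x = 0" "b = rat_mpoly_eval P y"
    using assms(2) by (force simp: eval_pairs_def)
  moreover from this have "P = 0"
    using assms(1) by (simp add: rat_alg_independent_def)
  ultimately show ?thesis
    by (simp add: rat_mpoly_eval_zero)
qed

lemma eval_pairs_sum:
  "(\<And>i. i \<in> A \<Longrightarrow> (f i, g i) \<in> eval_pairs n x y) \<Longrightarrow> (sum f A, sum g A) \<in> eval_pairs n x y"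
  using eval_pairs_of_rat[of 0]
  by (induction A rule: infinite_finite_induct) (auto intro: eval_pairs_add)

lemma eval_pairs_prod:
  "(\<And>i. i \<in> A \<Longrightarrow> (f i, g i) \<in> eval_pairs n x y) \<Longrightarrow> (prod f A, prod g A) \<in> eval_pairs n x y"
  using eval_pairs_of_rat[of 1]
  by (induction A rule: infinite_finite_induct) (auto intro: eval_pairs_mult)

text \<open>By the Leibniz formula the determinant is a polynomial in the entries with coefficients
  1 and -1.\<close>

lemma eval_pairs_det:
  assumes "\<And>i j. i < r \<Longrightarrow> j < r \<Longrightarrow> (A i j, B i j) \<in> eval_pairs n x y"
  shows "(Determinant.det (mat r r (\<lambda>(i, j). A i j)), Determinant.det (mat r r (\<lambda>(i, j). B i j)))
    \<in> eval_pairs n x y"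
proof -
  have sign: "(signof \<pi>, signof \<pi>) \<in> eval_pairs n x y" for \<pi> :: "nat \<Rightarrow> nat"
    using eval_pairs_of_rat[of 1] eval_pairs_of_rat[of "- 1"] by (auto simp: sign_def)
  have perm: "\<pi> i < r" if "\<pi> permutes {0..<r}" "i < r" for \<pi> i
    using permutes_in_image[OF that(1), of i] that(2) by simp
  show ?thesis
    unfolding det_def'[OF mat_carrier]
    by (intro eval_pairs_sum eval_pairs_mult sign eval_pairs_prod) (use perm assms in auto)
qed

section \<open>Rank and minors\<close>

text \<open>The ambient space may have infinite dimension, so \<open>B\<close> is compared with a
  basis drawn from the finite set \<open>V\<close>.\<close>

lemma (in vector_space) card_le_dim_of_independent:
  assumes "finite V" "B \<subseteq> V" "independent B"
  shows "card B \<le> dim V"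
proof -
  obtain C where C: "C \<subseteq> V" "V \<subseteq> span C" "card C = dim V"
    using basis_exists by metis
  have "finite C"
    using C(1) assms(1) by (rule finite_subset)
  moreover have "B \<subseteq> span C"
    using assms(2) C(2) by (rule order_trans)
  ultimately show ?thesis
    using independent_span_bound[of C B] assms(3) C(3) by simp
qed

text \<open>A relation evaluated at the points \<open>x k\<close> says that the square matrix
  annihilates the coefficient vector.\<close>

lemma nonzero_minor_imp_independent:
  fixes f :: "nat \<Rightarrow> 'i \<Rightarrow> 'a::field"
  assumes det: "Determinant.det (mat n n (\<lambda>(k, j). f j (x k))) \<noteq> 0"
    and zero: "\<And>k. k < n \<Longrightarrow> (\<Sum>j<n. c j * f j (x k)) = 0"
    and j: "j < n"
  shows "c j = 0"
proof -
  let ?M = "mat n n (\<lambda>(k, j). f j (x k))"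
  have "?M *\<^sub>v vec n c = 0\<^sub>v n"
    using zero by (intro eq_vecI) (auto simp: scalar_prod_def atLeast0LessThan mult.commute)
  then have "vec n c = 0\<^sub>v n"
    using det det_0_iff_vec_prod_zero[of ?M n] vec_carrier[of n c] by (meson mat_carrier)
  then show ?thesis
    using j by (metis index_vec index_zero_vec(1))
qed

text \<open>Expanding along the last row, the determinant is a linear combination of the functions,
  and the coefficient of the last one is the nonzero minor of smaller size.\<close>

lemma independent_imp_nonzero_minor:
  fixes f :: "nat \<Rightarrow> 'i \<Rightarrow> 'a::field"
  assumes "\<And>c. (\<And>i. i \<in> I \<Longrightarrow> (\<Sum>j<n. c j * f j i) = 0) \<Longrightarrow> \<forall>j<n. c j = 0"
  shows "\<exists>x. (\<forall>k<n. x k \<in> I) \<and> Determinant.det (mat n n (\<lambda>(k, j). f j (x k))) \<noteq> 0"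
  using assms
proof (induction n)
  case (Suc n)
  have "\<forall>j<n. c j = 0" if c: "\<And>i. i \<in> I \<Longrightarrow> (\<Sum>j<n. c j * f j i) = 0" for c
  proof -
    \<comment> \<open>A relation among the first \<open>n\<close> functions is padded by a zero
      coefficient, so that the hypothesis for \<open>Suc n\<close> applies.\<close>
    have "(\<Sum>j<n. (c(n := 0)) j * f j i) = (\<Sum>j<n. c j * f j i)" for i
      by (intro sum.cong) auto
    then have "\<forall>j<Suc n. (c(n := 0)) j = 0"
      using c by (intro Suc.prems) simp
    then show ?thesis
      by (metis fun_upd_other less_Suc_eq less_irrefl)
  qed
  then obtain x where x: "\<forall>k<n. x k \<in> I"
      and det: "Determinant.det (mat n n (\<lambda>(k, j). f j (x k))) \<noteq> 0"
    using Suc.IH by blast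
  \<comment> \<open>The induction hypothesis supplies the first \<open>n\<close> rows; the point
    \<open>i\<close> of the last row is left free.\<close>
  define M where "M i = mat (Suc n) (Suc n) (\<lambda>(k, j). f j ((x(n := i)) k))" for i
  \<comment> \<open>The matrix left after deleting the last row and column \<open>j\<close>. It does
    not involve \<open>i\<close>, so the coefficients \<open>C j\<close> are constants.\<close>
  define D where "D j = mat n n (\<lambda>(k, l). f (if l < j then l else Suc l) (x k))" for j
  define C where "C j = (- 1) ^ (n + j) * Determinant.det (D j)" for j
  have del: "mat_delete (M i) n j = D j" for i j
    by (rule eq_matI) (auto simp: M_def D_def mat_delete_def)
  have expand: "Determinant.det (M i) = (\<Sum>j<Suc n. C j * f j i)" for i
  proof -
    have "Determinant.det (M i) = (\<Sum>j<Suc n. M i $$ (n, j) * cofactor (M i) n j)"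
      by (rule laplace_expansion_row) (auto simp: M_def)
    also have "\<dots> = (\<Sum>j<Suc n. C j * f j i)"
      by (intro sum.cong refl) (simp add: cofactor_def del C_def, simp add: M_def)
    finally show ?thesis .
  qed
  have "D n = mat n n (\<lambda>(k, j). f j (x k))"
    by (rule eq_matI) (auto simp: D_def)
  then have "C n \<noteq> 0"
    using det by (simp add: C_def)
  then obtain i where i: "i \<in> I" "(\<Sum>j<Suc n. C j * f j i) \<noteq> 0"
    using Suc.prems[of C] by blast
  then have "Determinant.det (M i) \<noteq> 0"
    by (simp only: expand not_False_eq_True)
  then show ?case
    using x i(1) unfolding M_def by (intro exI[of _ "x(n := i)"]) auto
qed simp

text \<open>The minor makes the selected columns independent. As the rank concerns a set of columns,
  they must also be shown distinct.\<close>

lemma minor_le_matrix_rank: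
  fixes A :: "'i \<Rightarrow> 'j \<Rightarrow> 'a::field"
  assumes fin: "finite ((\<lambda>j i. if i \<in> I then A i j else 0) ` J)"
    and x: "\<And>k. k < n \<Longrightarrow> x k \<in> I" and g: "\<And>k. k < n \<Longrightarrow> g k \<in> J"
    and det: "Determinant.det (mat n n (\<lambda>(k, j). A (x k) (g j))) \<noteq> 0"
  shows "n \<le> matrix_rank I J A"
proof -
  interpret fs: vector_space "fun_scale :: 'a \<Rightarrow> ('i \<Rightarrow> 'a) \<Rightarrow> 'i \<Rightarrow> 'a"
    by (rule vector_space_fun_scale)
  define F where "F j i = (if i \<in> I then A i (g j) else 0)" for j i
  have "mat n n (\<lambda>(k, j). A (x k) (g j)) = mat n n (\<lambda>(k, j). F j (x k))"
    using x by (intro eq_matI) (auto simp: F_def)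
  then have det': "Determinant.det (mat n n (\<lambda>(k, j). F j (x k))) \<noteq> 0"
    using det by simp
  have indep: "c j = 0" if "(\<Sum>j<n. fun_scale (c j) (F j)) = 0" "j < n" for c j
  proof (rule nonzero_minor_imp_independent[where f = F and x = x and n = n])
    show "Determinant.det (mat n n (\<lambda>(k, j). F j (x k))) \<noteq> 0" "j < n"
      by fact+
    fix k
    have "(\<Sum>j<n. fun_scale (c j) (F j)) i = (\<Sum>j<n. c j * F j i)" for i
      by (induction n) (simp_all add: fun_scale_def)
    then show "(\<Sum>j<n. c j * F j (x k)) = 0"
      using that(1) by (metis zero_fun_apply)
  qed
  have inj: "inj_on F {..<n}"
  proof (rule inj_onI, rule ccontr)
    fix a b assume ab: "a \<in> {..<n}" "b \<in> {..<n}" "F a = F b" "a \<noteq> b"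
    \<comment> \<open>Two equal columns would satisfy the nontrivial relation with coefficients 1
      and -1.\<close>
    define c :: "nat \<Rightarrow> 'a" where "c j = (if j = a then 1 else if j = b then - 1 else 0)" for j
    have "(\<Sum>j<n. fun_scale (c j) (F j)) = (\<Sum>j\<in>{a, b}. fun_scale (c j) (F j))"
      using ab by (intro sum.mono_neutral_right) (auto simp: c_def)
    also have "\<dots> = 0"
      using ab by (simp add: c_def)
    finally show False
      using indep[of c a] ab by (simp add: c_def)
  qed
  have "fs.independent (F ` {..<n})"
  proof (rule fs.independent_if_scalars_zero)
    fix c w assume "(\<Sum>w\<in>F ` {..<n}. fun_scale (c w) w) = 0" and w: "w \<in> F ` {..<n}"
    then have "(\<Sum>j<n. fun_scale (c (F j)) (F j)) = 0"
      by (simp add: sum.reindex[OF inj])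
    then show "c w = 0"
      using indep[of "\<lambda>j. c (F j)"] w by auto
  qed simp
  moreover have "F ` {..<n} \<subseteq> (\<lambda>j i. if i \<in> I then A i j else 0) ` J"
    using g by (auto simp: F_def fun_eq_iff)
  ultimately have "card (F ` {..<n}) \<le> matrix_rank I J A"
    unfolding matrix_rank_def by (intro fs.card_le_dim_of_independent fin)
  then show ?thesis
    by (simp add: card_image[OF inj])
qed

text \<open>A basis chosen among the columns gives the column indices; its independence as functions
  on \<open>I\<close> then gives the rows.\<close>

lemma matrix_rank_minor:
  fixes A :: "'i \<Rightarrow> 'j \<Rightarrow> 'a::field"
  assumes fin: "finite ((\<lambda>j i. if i \<in> I then A i j else 0) ` J)"
  defines "n \<equiv> matrix_rank I J A"
  shows "\<exists>x g. (\<forall>k<n. x k \<in> I) \<and> (\<forall>k<n. g k \<in> J) \<and>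
    Determinant.det (mat n n (\<lambda>(k, j). A (x k) (g j))) \<noteq> 0"
proof -
  interpret fs: vector_space "fun_scale :: 'a \<Rightarrow> ('i \<Rightarrow> 'a) \<Rightarrow> 'i \<Rightarrow> 'a"
    by (rule vector_space_fun_scale)
  define col where "col j i = (if i \<in> I then A i j else 0)" for j i
  have col: "(\<lambda>j i. if i \<in> I then A i j else 0) = col"
    by (simp add: col_def fun_eq_iff)
  obtain B where B: "B \<subseteq> col ` J" "fs.independent B" "card B = fs.dim (col ` J)"
    by (rule fs.basis_exists[of "col ` J"])
  then have card_B: "card B = n"
    by (simp only: n_def matrix_rank_def col)
  have "finite B"
    using B(1) fin unfolding col by (rule finite_subset)
  then obtain h where h: "bij_betw h {..<n} B"
    using ex_bij_betw_nat_finite[of B] card_B by (auto simp: atLeast0LessThan)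
  have "\<forall>k. \<exists>j. k < n \<longrightarrow> j \<in> J \<and> h k = col j"
    using B(1) bij_betwE[OF h] by blast
  then obtain g where g: "\<And>k. k < n \<Longrightarrow> g k \<in> J" "\<And>k. k < n \<Longrightarrow> h k = col (g k)"
    by metis
  have "\<exists>x. (\<forall>k<n. x k \<in> I) \<and> Determinant.det (mat n n (\<lambda>(k, j). col (g j) (x k))) \<noteq> 0"
  proof (rule independent_imp_nonzero_minor)
    fix c assume c: "\<And>i. i \<in> I \<Longrightarrow> (\<Sum>j<n. c j * col (g j) i) = 0"
    \<comment> \<open>Columns vanish outside \<open>I\<close>, so a relation on \<open>I\<close>
      holds everywhere.\<close>
    have "(\<Sum>j<n. c j * col (g j) i) = 0" for i
      using c by (cases "i \<in> I") (auto simp: col_def)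
    moreover have "(\<Sum>j<n. fun_scale (c j) (col (g j))) i = (\<Sum>j<n. c j * col (g j) i)" for i
      by (induction n) (simp_all add: fun_scale_def)
    ultimately have "(\<Sum>j<n. fun_scale (c j) (col (g j))) = 0"
      by (simp add: fun_eq_iff)
    then have "(\<Sum>j<n. fun_scale (c j) (h j)) = 0"
      using g(2) by simp
    moreover have "(\<Sum>j<n. fun_scale (c j) (h j)) =
        (\<Sum>w\<in>B. fun_scale (c (the_inv_into {..<n} h w)) w)"
      using h by (subst sum.reindex_bij_betw[OF h, symmetric])
        (auto simp: bij_betw_def the_inv_into_f_f intro!: sum.cong)
    ultimately have "c (the_inv_into {..<n} h w) = 0" if "w \<in> B" for w
      using fs.independentD[OF B(2) \<open>finite B\<close> subset_refl _ that] by metis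
    then show "\<forall>j<n. c j = 0"
      using h by (metis bij_betwE bij_betw_imp_inj_on lessThan_iff the_inv_into_f_f)
  qed
  then obtain x where x: "\<forall>k<n. x k \<in> I"
      "Determinant.det (mat n n (\<lambda>(k, j). col (g j) (x k))) \<noteq> 0"
    by blast
  have "mat n n (\<lambda>(k, j). col (g j) (x k)) = mat n n (\<lambda>(k, j). A (x k) (g j))"
    using x(1) by (intro eq_matI) (auto simp: col_def)
  then show ?thesis
    using x g(1) by metis
qed

text \<open>A nonzero minor of \<open>B\<close> of maximal size comes from the same polynomial as
  the corresponding minor of \<open>A\<close>. If the latter were 0, genericity of \<open>x\<close>
  would make the former 0.\<close>

lemma matrix_rank_le_of_eval_pairs:
  fixes A :: "'i \<Rightarrow> 'j \<Rightarrow> 'k::field_char_0" and B :: "'h \<Rightarrow> 'j \<Rightarrow> 'l::field_char_0"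
  assumes ind: "rat_alg_independent n x"
    and finA: "finite ((\<lambda>j i. if i \<in> I then A i j else 0) ` J)"
    and finB: "finite ((\<lambda>j i. if i \<in> \<phi> ` I then B i j else 0) ` J)"
    and pair: "\<And>i j. i \<in> I \<Longrightarrow> j \<in> J \<Longrightarrow> (A i j, B (\<phi> i) j) \<in> eval_pairs n x y"
  shows "matrix_rank (\<phi> ` I) J B \<le> matrix_rank I J A"
proof -
  define r where "r = matrix_rank (\<phi> ` I) J B"
  obtain z g where z: "\<forall>k<r. z k \<in> \<phi> ` I" and g: "\<forall>k<r. g k \<in> J"
    and det: "Determinant.det (mat r r (\<lambda>(k, j). B (z k) (g j))) \<noteq> 0"
    using matrix_rank_minor[OF finB] unfolding r_def by blast
  have "\<forall>k. \<exists>i. k < r \<longrightarrow> i \<in> I \<and> z k = \<phi> i"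
    using z by blast
  then obtain w where w: "\<And>k. k < r \<Longrightarrow> w k \<in> I" "\<And>k. k < r \<Longrightarrow> z k = \<phi> (w k)"
    by metis
  have "(Determinant.det (mat r r (\<lambda>(k, j). A (w k) (g j))),
      Determinant.det (mat r r (\<lambda>(k, j). B (z k) (g j)))) \<in> eval_pairs n x y"
    by (rule eval_pairs_det) (use w g pair in auto)
  then have "Determinant.det (mat r r (\<lambda>(k, j). A (w k) (g j))) \<noteq> 0"
    using det eval_pairs_zero_left[OF ind] by metis
  then show ?thesis
    using minor_le_matrix_rank[OF finA] w(1) g unfolding r_def by blast
qed

section \<open>Comparison of the two ranks\<close>

lemma (in field_hom) hom_poly_of_int: "hom (poly (map_poly of_int P) x) = poly (map_poly of_int P) (hom x)"
  by (induction P) (simp_all add: map_poly_pCons hom_distribs)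

text \<open>The basis is taken among the values \<open>x d\<close> themselves, so that for the
  logarithm its members are again logarithms of elements of \<open>D\<close>, as the Schanuel
  conjecture demands.\<close>

lemma exists_rational_basis:
  fixes x :: "'i \<Rightarrow> 'k::field_char_0"
  assumes "finite D"
  shows "\<exists>n (b :: nat \<Rightarrow> 'i). (\<forall>i<n. b i \<in> D) \<and> rat_lin_independent n (\<lambda>i. x (b i)) \<and>
    (\<forall>d\<in>D. \<exists>q. x d = (\<Sum>i<n. of_rat (q i) * x (b i)))"
proof -
  interpret rs: vector_space "rat_scale :: rat \<Rightarrow> 'k \<Rightarrow> 'k"
    by (rule vector_space_rat_scale)
  obtain B where B: "B \<subseteq> x ` D" "rs.independent B" "x ` D \<subseteq> rs.span B"
    by (rule rs.maximal_independent_subset[of "x ` D"])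
  have fin: "finite B"
    using B(1) finite_imageI[OF assms] by (rule finite_subset)
  then obtain h where h: "bij_betw h {..<card B} B"
    using ex_bij_betw_nat_finite[of B] by (auto simp: atLeast0LessThan)
  define n where "n = card B"
  have "\<forall>k. \<exists>d. k < n \<longrightarrow> d \<in> D \<and> h k = x d"
    using B(1) bij_betwE[OF h] unfolding n_def by blast
  then obtain b where b: "\<And>k. k < n \<Longrightarrow> b k \<in> D" "\<And>k. k < n \<Longrightarrow> h k = x (b k)"
    by metis
  have reindex: "(\<Sum>w\<in>B. rat_scale (c w) w) = (\<Sum>i<n. of_rat (c (h i)) * x (b i))" for c
    unfolding sum.reindex_bij_betw[OF h, symmetric] n_def[symmetric]
    by (intro sum.cong) (simp_all add: rat_scale_def b)
  have "rat_lin_independent n (\<lambda>i. x (b i))"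
    unfolding rat_lin_independent_def
  proof (intro allI impI)
    fix q i assume q: "(\<Sum>i<n. of_rat (q i) * x (b i)) = 0" and i: "i < n"
    \<comment> \<open>Coefficients indexed by numbers become coefficients on the basis vectors,
      through the inverse of the enumeration \<open>h\<close>.\<close>
    let ?c = "\<lambda>w. q (the_inv_into {..<n} h w)"
    have inv: "?c (h j) = q j" if "j < n" for j
      using h that by (simp add: bij_betw_def n_def the_inv_into_f_f)
    have "(\<Sum>w\<in>B. rat_scale (?c w) w) = 0"
      unfolding reindex using q inv by simp
    then have "?c (h i) = 0"
      using rs.independentD[OF B(2) fin subset_refl, of ?c] bij_betwE[OF h] i n_def by blast
    then show "q i = 0"
      using inv i by simp
  qed
  moreover have "\<exists>q. x d = (\<Sum>i<n. of_rat (q i) * x (b i))" if d: "d \<in> D" for d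
  proof -
    have "x d \<in> rs.span B"
      using B(3) d by blast
    then obtain c where "x d = (\<Sum>w\<in>B. rat_scale (c w) w)"
      unfolding rs.span_finite[OF fin] by blast
    then have "x d = (\<Sum>i<n. of_rat (c (h i)) * x (b i))"
      by (simp only: reindex)
    then show ?thesis
      by (rule exI[of _ "\<lambda>i. c (h i)"])
  qed
  ultimately show ?thesis
    using b(1) by blast
qed

theorem theorem6p1:
  fixes p :: nat and v :: "'k::field_char_0 \<Rightarrow> real" and log\<^sub>p :: "'k \<Rightarrow> 'k"
    and \<epsilon> :: "'m::field_char_0" and S\<^sub>p :: "('m \<Rightarrow> 'k) set"
  assumes "padic_complex_field p v"
    and "is_padic_log p v log\<^sub>p"
    and "finite_Galois_over_rat TYPE('m)"
    and "weak_Minkowski_unit \<epsilon>"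
    and "\<forall>\<sigma>\<in>(Emb :: ('m \<Rightarrow> 'k) set). \<forall>g\<in>Gal_rat. v (\<sigma> (g \<epsilon>) - 1) < 1"
    and "S\<^sub>p \<subseteq> Emb"
    and "padic_Schanuel_conjecture log\<^sub>p"
  shows "matrix_rank S\<^sub>p Gal_rat (\<lambda>\<sigma> g. log\<^sub>p (\<sigma> (g \<epsilon>)))
    \<ge> (SUP \<psi>\<in>{\<psi>::'k \<Rightarrow> complex. field_isom \<psi>}.
         matrix_rank ((\<lambda>\<sigma>. \<psi> \<circ> \<sigma>) ` S\<^sub>p) Gal_rat (\<lambda>\<tau> g. ln (cmod (\<tau> (g \<epsilon>)))))"
proof -
  interpret padic_complex_field p v
    by (rule assms(1))
  \<comment> \<open>A monic integer equation for \<open>\<epsilon>\<close> is preserved by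
    automorphisms and embeddings; the finiteness and algebraicity facts below come from it.\<close>
  obtain P :: "int poly" where P: "poly (map_poly of_int P) \<epsilon> = 0" "lead_coeff P = 1"
    using assms(4) by (auto simp: weak_Minkowski_unit_def int_units_def algebraic_int_altdef_ipoly)
  have roots_finite: "finite {z :: 'c::field_char_0. poly (map_poly of_int P) z = 0}"
  proof (rule poly_roots_finite)
    have "coeff (map_poly of_int P :: 'c poly) (degree P) = 1"
      using P(2) by (simp add: coeff_map_poly)
    then show "(map_poly of_int P :: 'c poly) \<noteq> 0"
      by auto
  qed
  have gal_root: "poly (map_poly of_int P) (g \<epsilon>) = 0" if "g \<in> Gal_rat" for g
  proof -
    interpret field_isom g
      using that by (simp add: Gal_rat_def)
    show ?thesis
      using hom_poly_of_int[of P \<epsilon>] P(1) by simp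
  qed
  \<comment> \<open>Columns of both matrices depend on \<open>g\<close> only through
    \<open>g \<epsilon>\<close>, so a finite orbit gives finitely many columns.\<close>
  define orbit where "orbit = (\<lambda>g. g \<epsilon>) ` Gal_rat"
  have orbit_finite: "finite orbit"
    unfolding orbit_def
    by (rule finite_subset[OF _ roots_finite]) (use gal_root in auto)
  define D where "D = {\<sigma> (g \<epsilon>) | \<sigma> g. \<sigma> \<in> S\<^sub>p \<and> g \<in> Gal_rat}"
  have D_root: "poly (map_poly of_int P) d = 0" if dD: "d \<in> D" for d
  proof -
    obtain \<sigma> g where d: "d = \<sigma> (g \<epsilon>)" "\<sigma> \<in> S\<^sub>p" "g \<in> Gal_rat"
      using dD by (auto simp: D_def)
    interpret field_hom \<sigma>
      using d(2) assms(6) by (auto simp: Emb_def)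
    show ?thesis
      using hom_poly_of_int[of P "g \<epsilon>"] gal_root[OF d(3)] by (simp add: d(1))
  qed
  have D_finite: "finite D"
    by (rule finite_subset[OF _ roots_finite]) (use D_root in auto)
  have D_unit: "d \<in> principal_units" if "d \<in> D" for d
    using that assms(5,6) by (auto simp: D_def principal_units_def)
  have D_algebraic: "algebraic d" if "d \<in> D" for d
    using D_root[OF that] P(2) algebraic_int_altdef_ipoly algebraic_int_imp_algebraic by blast
  obtain n b where b: "\<forall>i<n. b i \<in> D" "rat_lin_independent n (\<lambda>i. log\<^sub>p (b i))"
    and span: "\<forall>d\<in>D. \<exists>q. log\<^sub>p d = (\<Sum>i<n. of_rat (q i) * log\<^sub>p (b i))"
    using exists_rational_basis[OF D_finite, of log\<^sub>p] by blast
  have alg_indep: "rat_alg_independent n (\<lambda>i. log\<^sub>p (b i))"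
    using assms(7) b D_algebraic D_unit principal_unit_nonzero
    unfolding padic_Schanuel_conjecture_def by blast
  have "matrix_rank ((\<lambda>\<sigma>. \<psi> \<circ> \<sigma>) ` S\<^sub>p) Gal_rat (\<lambda>\<tau> g. ln (cmod (\<tau> (g \<epsilon>))))
      \<le> matrix_rank S\<^sub>p Gal_rat (\<lambda>\<sigma> g. log\<^sub>p (\<sigma> (g \<epsilon>)))"
    if psi: "field_isom \<psi>" for \<psi> :: "'k \<Rightarrow> complex"
  proof (rule matrix_rank_le_of_eval_pairs[OF alg_indep, where y = "\<lambda>i. ln (cmod (\<psi> (b i)))"])
    have "(\<lambda>g i. if i \<in> S\<^sub>p then log\<^sub>p (i (g \<epsilon>)) else 0) ` Gal_rat
        = (\<lambda>e i. if i \<in> S\<^sub>p then log\<^sub>p (i e) else 0) ` orbit"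
      by (simp add: orbit_def image_image)
    then show "finite ((\<lambda>g i. if i \<in> S\<^sub>p then log\<^sub>p (i (g \<epsilon>)) else 0) ` Gal_rat)"
      using orbit_finite by simp
    let ?T = "(\<lambda>\<sigma>. \<psi> \<circ> \<sigma>) ` S\<^sub>p"
    have "(\<lambda>g i. if i \<in> ?T then ln (cmod (i (g \<epsilon>))) else 0) ` Gal_rat
        = (\<lambda>e i. if i \<in> ?T then ln (cmod (i e)) else 0) ` orbit"
      by (simp add: orbit_def image_image)
    then show "finite ((\<lambda>g i. if i \<in> ?T then ln (cmod (i (g \<epsilon>))) else 0) ` Gal_rat)"
      using orbit_finite by simp
    fix \<sigma> g assume "\<sigma> \<in> S\<^sub>p" "g \<in> (Gal_rat :: ('m \<Rightarrow> 'm) set)"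
    then have d: "\<sigma> (g \<epsilon>) \<in> D" (is "?d \<in> D")
      by (auto simp: D_def)
    then obtain q where q: "log\<^sub>p ?d = (\<Sum>i<n. of_rat (q i) * log\<^sub>p (b i))"
      using span by blast
    \<comment> \<open>The expression of \<open>log\<^sub>p ?d\<close> in the basis becomes a
      relation of \<open>Suc n\<close> terms, with \<open>?d\<close> appended at index
      \<open>n\<close> and coefficient -1.\<close>
    define \<beta> where "\<beta> i = (if i < n then b i else ?d)" for i
    define q' where "q' i = (if i < n then q i else - 1)" for i
    have "(\<Sum>i<Suc n. of_rat (q' i) * ln (cmod (\<psi> (\<beta> i)))) = 0"
    proof (rule padic_log_relation_imp_ln_relation[OF assms(2)])
      show "field_hom \<psi>"
        using psi by (simp add: field_isom_def)
      show "\<beta> i \<in> principal_units" for i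
        using b(1) d D_unit by (simp add: \<beta>_def)
      show "(\<Sum>i<Suc n. of_rat (q' i) * log\<^sub>p (\<beta> i)) = 0"
        by (simp add: \<beta>_def q'_def q of_rat_minus)
    qed simp
    then have "ln (cmod (\<psi> ?d)) = (\<Sum>i<n. of_rat (q i) * ln (cmod (\<psi> (b i))))"
      by (simp add: \<beta>_def q'_def of_rat_minus)
    then have "ln (cmod ((\<psi> \<circ> \<sigma>) (g \<epsilon>))) = (\<Sum>i<n. of_rat (q i) * ln (cmod (\<psi> (b i))))"
      by simp
    \<comment> \<open>Both entries are values of the linear form with coefficients
      \<open>q\<close>.\<close>
    then show "(log\<^sub>p ?d, ln (cmod ((\<psi> \<circ> \<sigma>) (g \<epsilon>))))
        \<in> eval_pairs n (\<lambda>i. log\<^sub>p (b i)) (\<lambda>i. ln (cmod (\<psi> (b i))))"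
      unfolding q by (auto intro!: eval_pairs_sum eval_pairs_mult eval_pairs_of_rat eval_pairs_var)
  qed
  then show ?thesis
    \<comment> \<open>The supremum of the empty set of naturals is 0; otherwise the bound for each
      \<open>\<psi>\<close> suffices.\<close>
    by (cases "{\<psi>::'k \<Rightarrow> complex. field_isom \<psi>} = {}") (auto intro: cSUP_least)
qed

end
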